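(* Let $k,q$ be positive integers and let $a>0$. Then $$ \sum_{n=0}^{\infty}\frac{(-1)^n}{(n+a)^{4k(q+1)}}\sum_{i=0}^{\infty}\frac{(-1)^i(n+a)^{2k}}{(n+a)^{2k}+(i+a)^{2k}} =\frac12\sum_{p=1}^{2q+1}(-1)^{p+1}\zeta_E(2kp,a)\,\zeta_E\bigl(2k(2q-p+2),a\bigr). $$
   Context: The alternating Hurwitz zeta function is $\zeta_E(z,x)=\sum_{n=0}^{\infty}\frac{(-1)^n}{(n+x)^z}$ for $\operatorname{Re}(z)>0$ and $x\neq0,-1,-2,\dots$. *)

theory Defs
  imports "HOL-Analysis.Analysis"
begin

text \<open>
  The alternating Hurwitz zeta function, to be used for \<open>Re z > 0\<close> and
  \<open>x \<notin> \<int>\<^sub>\<le>\<^sub>0\<close>. For \<open>Re z \<le> 1\<close> the series converges only conditionally, so it is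
  the ordered sum \<open>suminf\<close> and not \<open>infsum\<close>. The power is the principal branch.
\<close>

definition zeta_E :: "complex \<Rightarrow> complex \<Rightarrow> complex" where
  "zeta_E z x = (\<Sum>n. (-1) ^ n / (of_nat n + x) powr z)"

end

theory Submission
  imports Defs
begin

text \<open>
  With \<open>s n = (-1) ^ n\<close>, \<open>u n = 1 / (n + a) ^ (2 * k)\<close> and \<open>m = 2 * q + 1\<close>, the left-hand side is
  the absolutely convergent double sum of \<open>s n * s i * u n ^ (m + 1) * u i / (u n + u i)\<close>.
  Averaging it with its transpose replaces \<open>u n ^ m\<close> by \<open>(u n ^ m + u i ^ m) / 2\<close>; as \<open>m\<close> is odd,
  \<open>u n + u i\<close> divides \<open>u n ^ m + u i ^ m\<close>, and each term of the quotient gives a product of two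
  single sums.
\<close>

text \<open>For odd \<open>m\<close> the left factor is \<open>x ^ m - (- y) ^ m\<close>, a
  difference of powers divisible by \<open>x - (- y)\<close>. The extra \<open>x * y\<close> raises
  both exponents in the quotient by one, so \<open>p\<close> and \<open>m + 1 - p\<close> are never
  zero and each power can later be summed as a series.\<close>

lemma odd_power_sum_factorization:
  fixes x y :: "'a :: comm_ring_1"
  assumes "odd m"
  shows "x * y * (x ^ m + y ^ m)
    = (x + y) * (\<Sum>p = 1..m. (-1) ^ (p + 1) * x ^ p * y ^ (m + 1 - p))"
proof -
  have "x ^ m + y ^ m = x ^ m - (- y) ^ m"
    using assms by simp
  also have "\<dots> = (x + y) * (\<Sum>i<m. (- y) ^ (m - Suc i) * x ^ i)"
    by (subst power_diff_sumr2) simp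
  finally have "x * y * (x ^ m + y ^ m)
      = (x + y) * (\<Sum>i<m. x * y * ((- y) ^ (m - Suc i) * x ^ i))"
    by (simp add: sum_distrib_left mult_ac)
  also have "(\<Sum>i<m. x * y * ((- y) ^ (m - Suc i) * x ^ i))
      = (\<Sum>i<m. (-1) ^ (Suc i + 1) * x ^ Suc i * y ^ (m + 1 - Suc i))"
  proof (rule sum.cong)
    fix i assume "i \<in> {..<m}"
    then have i: "i < m" by simp
    then have "even (m - Suc i) = even i"
      using assms by auto
    then have "(- y) ^ (m - Suc i) = (-1) ^ i * y ^ (m - Suc i)"
      by (cases "even i") simp_all
    moreover have "m + 1 - Suc i = Suc (m - Suc i)"
      using i by simp
    ultimately show "x * y * ((- y) ^ (m - Suc i) * x ^ i)
        = (-1) ^ (Suc i + 1) * x ^ Suc i * y ^ (m + 1 - Suc i)"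
      by (simp add: mult_ac)
  qed simp
  also have "\<dots> = (\<Sum>p = 1..m. (-1) ^ (p + 1) * x ^ p * y ^ (m + 1 - p))"
    by (simp only: sum.atLeast1_atMost_eq One_nat_def)
  finally show ?thesis .
qed

text \<open>Summability forces \<open>u n\<close> to tend to 0, so eventually
  \<open>u n < 1\<close>, and from there on \<open>u n ^ m\<close> is at most
  \<open>u n\<close>.\<close>

lemma summable_power_nonneg:
  fixes u :: "nat \<Rightarrow> real"
  assumes "summable u" "\<And>n. 0 \<le> u n" "0 < m"
  shows "summable (\<lambda>n. u n ^ m)"
proof (rule summable_comparison_test_ev[OF _ assms(1)])
  have "eventually (\<lambda>n. u n < 1) sequentially"
    using order_tendstoD(2)[OF summable_LIMSEQ_zero[OF assms(1)], of 1] by simp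
  then show "eventually (\<lambda>n. norm (u n ^ m) \<le> u n) sequentially"
  proof eventually_elim
    case (elim n)
    then show ?case
      using assms(2)[of n] power_decreasing[of 1 m "u n"] assms(3) by simp
  qed
qed

lemma has_sum_sum:
  fixes f :: "'a \<Rightarrow> 'b \<Rightarrow> 'c :: topological_comm_monoid_add"
  assumes "\<And>p. p \<in> P \<Longrightarrow> (f p has_sum S p) A"
  shows "((\<lambda>x. \<Sum>p\<in>P. f p x) has_sum (\<Sum>p\<in>P. S p)) A"
  using assms by (induction P rule: infinite_finite_induct) (simp_all add: has_sum_add)

text \<open>Absolute convergence of both factors makes the family of products unconditionally
  summable over all pairs. Summing it row by row gives \<open>f n * suminf g\<close> in row
  \<open>n\<close>, which identifies the total.\<close>

lemma has_sum_mult_real: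
  fixes f g :: "nat \<Rightarrow> real"
  assumes f: "summable (\<lambda>n. \<bar>f n\<bar>)" and g: "summable (\<lambda>n. \<bar>g n\<bar>)"
  shows "((\<lambda>(n, i). f n * g i) has_sum suminf f * suminf g) UNIV"
proof -
  have sum: "(h has_sum suminf h) UNIV" if "summable (\<lambda>n. \<bar>h n\<bar>)" for h :: "nat \<Rightarrow> real"
    using norm_summable_imp_has_sum[of h] that summable_rabs_cancel[OF that] by (simp add: summable_sums)
  have "(\<lambda>(n, i). \<bar>f n\<bar> * \<bar>g i\<bar>) summable_on UNIV \<times> UNIV"
  proof (rule summable_on_SigmaI)
    show "((\<lambda>i. case (n, i) of (n, i) \<Rightarrow> \<bar>f n\<bar> * \<bar>g i\<bar>) has_sum \<bar>f n\<bar> * (\<Sum>i. \<bar>g i\<bar>)) UNIV" for n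
      using has_sum_cmult_right[OF sum[of "\<lambda>i. \<bar>g i\<bar>"]] g by simp
    show "(\<lambda>n. \<bar>f n\<bar> * (\<Sum>i. \<bar>g i\<bar>)) summable_on UNIV"
      by (intro summable_on_cmult_left norm_summable_imp_summable_on) (simp add: f)
  qed auto
  then have "(\<lambda>x. norm (case x of (n, i) \<Rightarrow> f n * g i)) summable_on UNIV \<times> UNIV"
    by (simp only: case_prod_unfold real_norm_def abs_mult)
  then have "(\<lambda>(n, i). f n * g i) summable_on UNIV \<times> UNIV"
    by (rule abs_summable_summable)
  then have s: "((\<lambda>(n, i). f n * g i) has_sum infsum (\<lambda>(n, i). f n * g i) UNIV) (UNIV \<times> UNIV)"
    by simp
  have "((\<lambda>n. f n * suminf g) has_sum infsum (\<lambda>(n, i). f n * g i) UNIV) UNIV"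
    by (rule has_sum_SigmaD[OF s]) (simp add: has_sum_cmult_right sum[OF g])
  moreover have "((\<lambda>n. f n * suminf g) has_sum suminf f * suminf g) UNIV"
    by (intro has_sum_cmult_left sum f)
  ultimately show ?thesis
    using has_sum_unique s by (metis UNIV_Times_UNIV)
qed

text \<open>Bounded weights \<open>s\<close> keep every series dominated by one in \<open>u\<close>
  alone: an inner term is at most \<open>u i / u n\<close> in absolute value. The double series is
  therefore absolutely convergent, which licenses exchanging the two indices and summing in any
  order.\<close>

lemma alternating_double_series:
  fixes s u :: "nat \<Rightarrow> real"
  assumes u: "summable u" and pos: "\<And>n. 0 < u n" and s: "\<And>n. \<bar>s n\<bar> \<le> 1" and m: "odd m"
  shows "summable (\<lambda>i. s i * u i / (u n + u i))"
    and "(\<lambda>n. s n * u n ^ (m + 1) * (\<Sum>i. s i * u i / (u n + u i))) sums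
      (1 / 2 * (\<Sum>p = 1..m. (-1) ^ (p + 1) * (\<Sum>n. s n * u n ^ p) * (\<Sum>n. s n * u n ^ (m + 1 - p))))"
      (is "_ sums ?R")
proof -
  have abs1: "\<bar>s n\<bar> * c \<le> c" if "0 \<le> c" for n c
    using mult_right_mono[OF s that] by simp
  have weights: "summable (\<lambda>n. \<bar>s n * u n ^ p\<bar>)" if "0 < p" for p
  proof (rule summable_comparison_test'[of "\<lambda>n. u n ^ p" 0])
    show "summable (\<lambda>n. u n ^ p)"
      using u pos that by (intro summable_power_nonneg) (auto intro: less_imp_le)
    show "norm \<bar>s n * u n ^ p\<bar> \<le> u n ^ p" for n
      using pos[of n] by (simp add: abs_mult abs1)
  qed
  have inner: "summable (\<lambda>i. \<bar>s i * u i / (u n + u i)\<bar>)" for n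
  proof (rule summable_comparison_test'[of "\<lambda>i. u i / u n" 0])
    show "summable (\<lambda>i. u i / u n)"
      using u by (rule summable_divide)
    fix i
    have "u i / (u n + u i) \<le> u i / u n"
      using pos[of n] pos[of i] by (intro divide_left_mono) (auto intro: mult_pos_pos add_pos_pos)
    moreover have "0 \<le> u i / (u n + u i)"
      using pos[of n] pos[of i] by simp
    ultimately show "norm \<bar>s i * u i / (u n + u i)\<bar> \<le> u i / u n"
      using abs1[of "u i / (u n + u i)" i] pos[of n] pos[of i] by (simp add: abs_mult)
  qed
  then show "summable (\<lambda>i. s i * u i / (u n + u i))"
    by (rule summable_rabs_cancel)
  define F where "F = (\<lambda>(n, i). s n * s i * (u n ^ (m + 1) * u i / (u n + u i)))"
  have m0: "0 < m"
    using m by (rule odd_pos)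
  have "(\<lambda>(n, i). u n ^ m * u i) summable_on UNIV"
  proof -
    have "summable (\<lambda>n. \<bar>u n ^ m\<bar>)" "summable (\<lambda>n. \<bar>u n\<bar>)"
      using summable_power_nonneg[OF u _ m0] u pos by (simp_all add: less_imp_le)
    from has_sum_mult_real[OF this] show ?thesis
      by (rule has_sum_imp_summable)
  qed
  then have "(\<lambda>x. norm (F x)) summable_on UNIV"
  proof (rule Infinite_Sum.abs_summable_on_comparison_test')
    fix x :: "nat \<times> nat"
    obtain n i where x: "x = (n, i)" by force
    \<comment> \<open>One of the \<open>m + 1\<close> factors \<open>u n\<close> is paired with the
      denominator. That quotient is at most 1, which leaves the product majorant
      \<open>u n ^ m * u i\<close>.\<close>
    define c where "c = (u n ^ m * u i) * (u n / (u n + u i))"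
    have "0 \<le> c"
      using pos[of n] pos[of i] by (simp add: c_def)
    have "norm (F x) = \<bar>s n\<bar> * (\<bar>s i\<bar> * c)"
      using pos[of n] pos[of i] by (simp add: F_def x c_def abs_mult)
    also have "\<dots> \<le> \<bar>s i\<bar> * c"
      using \<open>0 \<le> c\<close> by (intro abs1) simp
    also have "\<dots> \<le> c"
      using \<open>0 \<le> c\<close> by (rule abs1)
    also have "c \<le> u n ^ m * u i"
      unfolding c_def using pos[of n] pos[of i] by (intro mult_left_le) simp_all
    finally show "norm (F x) \<le> (case x of (n, i) \<Rightarrow> u n ^ m * u i)"
      by (simp add: x)
  qed
  then have "F summable_on UNIV"
    by (rule abs_summable_summable)
  then have F: "(F has_sum infsum F UNIV) (UNIV \<times> UNIV)"
    by simp
  \<comment> \<open>An unconditional sum over pairs is invariant under swapping the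
    coordinates.\<close>
  have transpose: "((\<lambda>(n, i). F (i, n)) has_sum infsum F UNIV) UNIV"
    using F[unfolded has_sum_swap[of F]] by simp
  \<comment> \<open>The weights and the denominator are symmetric, so only the numerators add up.
    The factorization cancels the denominator and leaves finitely many terms in which
    \<open>n\<close> and \<open>i\<close> are separated.\<close>
  have symmetrized: "F (n, i) + F (i, n)
      = (\<Sum>p = 1..m. (-1) ^ (p + 1) * ((s n * u n ^ p) * (s i * u i ^ (m + 1 - p))))" for n i
  proof -
    have "u n + u i \<noteq> 0"
      using pos[of n] pos[of i] by linarith
    have "F (n, i) + F (i, n) = s n * s i * (u n * u i * (u n ^ m + u i ^ m) / (u n + u i))"
    proof -
      have "u i + u n = u n + u i"
        by simp
      moreover have "c * (x ^ (m + 1) * y / z) + d * (y ^ (m + 1) * x / z)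
          = c * (x * y * (x ^ m + y ^ m) / z)" if "c = d" for c d x y z :: real
        unfolding that by (simp add: distrib_left add_divide_distrib mult_ac)
      ultimately show ?thesis
        unfolding F_def by (simp only: prod.case mult.commute[of "s i"])
    qed
    also have "u n * u i * (u n ^ m + u i ^ m) / (u n + u i)
        = (\<Sum>p = 1..m. (-1) ^ (p + 1) * u n ^ p * u i ^ (m + 1 - p))"
      using \<open>u n + u i \<noteq> 0\<close> by (subst odd_power_sum_factorization[OF m]) simp
    finally show ?thesis
      by (simp add: sum_distrib_left mult_ac)
  qed
  have "((\<lambda>(n, i). F (n, i) + F (i, n)) has_sum infsum F UNIV + infsum F UNIV) UNIV"
    using has_sum_add[OF F[unfolded UNIV_Times_UNIV] transpose] by (simp add: case_prod_unfold)
  moreover have "((\<lambda>(n, i). F (n, i) + F (i, n)) has_sum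
      (\<Sum>p = 1..m. (-1) ^ (p + 1) * ((\<Sum>n. s n * u n ^ p) * (\<Sum>n. s n * u n ^ (m + 1 - p))))) UNIV"
    unfolding symmetrized case_prod_unfold
  proof (intro has_sum_sum has_sum_cmult_right)
    fix p assume "p \<in> {1..m}"
    \<comment> \<open>Both exponents stay positive even at the ends \<open>p = 1\<close> and
      \<open>p = m\<close>, so both single series converge absolutely.\<close>
    then have "0 < p" "0 < m + 1 - p" by auto
    from has_sum_mult_real[OF weights[OF this(1)] weights[OF this(2)]]
    show "((\<lambda>x. (s (fst x) * u (fst x) ^ p) * (s (snd x) * u (snd x) ^ (m + 1 - p))) has_sum
        (\<Sum>n. s n * u n ^ p) * (\<Sum>n. s n * u n ^ (m + 1 - p))) UNIV"
      by (simp add: case_prod_unfold)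
  qed
  \<comment> \<open>The symmetrized family has been summed in two ways; halving the resulting
    equation produces the factor \<open>1 / 2\<close>.\<close>
  ultimately have "infsum F UNIV + infsum F UNIV
      = (\<Sum>p = 1..m. (-1) ^ (p + 1) * ((\<Sum>n. s n * u n ^ p) * (\<Sum>n. s n * u n ^ (m + 1 - p))))"
    by (rule has_sum_unique)
  then have R: "infsum F UNIV = ?R"
    by (simp add: mult.assoc)
  \<comment> \<open>Summing \<open>F\<close> along rows recovers the iterated series; the
    unconditional sum over \<open>n\<close> then gives the ordered one.\<close>
  have "((\<lambda>n. s n * u n ^ (m + 1) * (\<Sum>i. s i * u i / (u n + u i))) has_sum infsum F UNIV) UNIV"
  proof (rule has_sum_SigmaD[OF F])
    fix n
    have "((\<lambda>i. s i * u i / (u n + u i)) has_sum (\<Sum>i. s i * u i / (u n + u i))) UNIV"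
      using norm_summable_imp_has_sum[of "\<lambda>i. s i * u i / (u n + u i)"] inner[of n]
        summable_rabs_cancel[OF inner[of n]] by (simp add: summable_sums)
    from has_sum_cmult_right[OF this, of "s n * u n ^ (m + 1)"]
    show "((\<lambda>i. F (n, i)) has_sum s n * u n ^ (m + 1) * (\<Sum>i. s i * u i / (u n + u i))) UNIV"
      by (simp add: F_def mult_ac)
  qed
  then show "(\<lambda>n. s n * u n ^ (m + 1) * (\<Sum>i. s i * u i / (u n + u i))) sums ?R"
    unfolding R by (rule has_sum_imp_sums)
qed

lemma summable_inverse_shifted_power:
  fixes a :: real
  assumes "0 \<le> a" "2 \<le> m"
  shows "summable (\<lambda>n. 1 / (real n + a) ^ m)"
\<comment> \<open>The comparison starts at 1 because at \<open>n = 0\<close> the majorant is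
  \<open>inverse 0 = 0\<close>.\<close>
proof (rule summable_comparison_test'[of "\<lambda>n. inverse (real n ^ m)" 1])
  show "summable (\<lambda>n. inverse (real n ^ m))"
    using assms(2) by (rule inverse_power_summable)
  show "norm (1 / (real n + a) ^ m) \<le> inverse (real n ^ m)" if "1 \<le> n" for n
    using that assms(1) by (simp add: field_simps power_mono)
qed

text \<open>The base \<open>n + a\<close> is nonzero, so its principal power with a natural exponent
  is the ordinary power. All terms are then real, and the embedding of the reals commutes with the
  convergent sum.\<close>

lemma zeta_E_of_nat_of_real:
  fixes a :: real
  assumes "0 < a" "summable (\<lambda>n. (-1) ^ n / (real n + a) ^ m)"
  shows "zeta_E (of_nat m) (of_real a) = of_real (\<Sum>n. (-1) ^ n / (real n + a) ^ m)"
proof -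
  have "(-1) ^ n / (of_nat n + complex_of_real a) powr of_nat m
      = of_real ((-1) ^ n / (real n + a) ^ m)" for n
  proof -
    have "of_nat n + complex_of_real a = of_real (real n + a)"
      by simp
    moreover have "complex_of_real (real n + a) \<noteq> 0"
      using assms(1) by (simp only: of_real_eq_0_iff)
    ultimately show ?thesis
      by (simp add: powr_nat')
  qed
  then show ?thesis
    using assms(2) by (simp add: zeta_E_def suminf_of_real)
qed

theorem corollary1p25:
  fixes k q :: nat and a :: real
  assumes "k > 0" and "q > 0" and "a > 0"
  shows "(\<forall>n::nat. summable (\<lambda>i::nat.
            (-1) ^ i * (real n + a) ^ (2 * k) / ((real n + a) ^ (2 * k) + (real i + a) ^ (2 * k))))
       \<and> summable (\<lambda>n::nat. (-1) ^ n / (real n + a) ^ (4 * k * (q + 1)) *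
            (\<Sum>i::nat. (-1) ^ i * (real n + a) ^ (2 * k) / ((real n + a) ^ (2 * k) + (real i + a) ^ (2 * k))))
       \<and> complex_of_real
           (\<Sum>n::nat. (-1) ^ n / (real n + a) ^ (4 * k * (q + 1)) *
              (\<Sum>i::nat. (-1) ^ i * (real n + a) ^ (2 * k) / ((real n + a) ^ (2 * k) + (real i + a) ^ (2 * k))))
         = 1 / 2 * (\<Sum>p = 1..2 * q + 1. (-1) ^ (p + 1) *
             zeta_E (of_nat (2 * k * p)) (of_real a) *
             zeta_E (of_nat (2 * k * (2 * q + 2 - p))) (of_real a))"
proof -
  \<comment> \<open>Since \<open>k > 0\<close>, the exponent is at least 2, so \<open>u\<close> is
    summable. Passing to reciprocals turns \<open>y / (y + z)\<close> into
    \<open>(1 / z) / (1 / y + 1 / z)\<close>, the inner term of the double series.\<close>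
  define u where "u n = 1 / (real n + a) ^ (2 * k)" for n :: nat
  define s :: "nat \<Rightarrow> real" where "s n = (-1) ^ n" for n
  have x: "0 < real n + a" for n
    using \<open>a > 0\<close> by simp
  have u: "summable u" "\<And>n. 0 < u n"
    using summable_inverse_shifted_power[of a "2 * k"] assms x by (simp_all add: u_def[abs_def])
  have s: "\<And>n. \<bar>s n\<bar> \<le> 1"
    by (simp add: s_def power_abs)
  have inner: "(-1) ^ i * (real n + a) ^ (2 * k) / ((real n + a) ^ (2 * k) + (real i + a) ^ (2 * k))
      = s i * u i / (u n + u i)" for n i
  proof -
    have "c * y / (y + z) = c * (1 / z) / (1 / y + 1 / z)" if "0 < y" "0 < z" for c y z :: real
    proof -
      have "1 / y + 1 / z = (y + z) / (y * z)"
        using that by (simp add: field_simps)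
      then show ?thesis
        using that by simp
    qed
    then show ?thesis
      using x[of n] x[of i] by (simp only: u_def s_def zero_less_power)
  qed
  have powers: "(-1) ^ n / (real n + a) ^ (2 * k * p) = s n * u n ^ p" for n p
    by (simp add: s_def u_def power_mult power_divide)
  \<comment> \<open>The exponent is \<open>2 * k * (m + 1)\<close> for the odd number
    \<open>m = 2 * q + 1\<close>.\<close>
  have outer: "(-1) ^ n / (real n + a) ^ (4 * k * (q + 1)) = s n * u n ^ (2 * q + 1 + 1)" for n
  proof -
    have "4 * k * (q + 1) = 2 * k * (2 * q + 1 + 1)"
      by simp
    then show ?thesis
      using powers by metis
  qed
  have zeta: "zeta_E (of_nat (2 * k * p)) (of_real a) = of_real (\<Sum>n. s n * u n ^ p)" if "0 < p" for p
  proof -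
    have "summable (\<lambda>n. s n * u n ^ p)"
    proof (rule summable_comparison_test'[of "\<lambda>n. u n ^ p" 0])
      show "summable (\<lambda>n. u n ^ p)"
        using u that by (intro summable_power_nonneg) (auto intro: less_imp_le)
      show "norm (s n * u n ^ p) \<le> u n ^ p" for n
        using u(2)[of n] by (simp add: s_def abs_mult power_abs)
    qed
    then show ?thesis
      using zeta_E_of_nat_of_real[of a "2 * k * p"] \<open>a > 0\<close> by (simp only: powers)
  qed
  have "odd (2 * q + 1)"
    by simp
  note double = alternating_double_series[where s = s and u = u, OF u s this]
  have "complex_of_real (\<Sum>n. s n * u n ^ (2 * q + 1 + 1) * (\<Sum>i. s i * u i / (u n + u i)))
      = 1 / 2 * (\<Sum>p = 1..2 * q + 1. (-1) ^ (p + 1) *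
          of_real (\<Sum>n. s n * u n ^ p) * of_real (\<Sum>n. s n * u n ^ (2 * q + 1 + 1 - p)))"
    unfolding sums_unique[OF double(2), symmetric] by simp
  also have "\<dots> = 1 / 2 * (\<Sum>p = 1..2 * q + 1. (-1) ^ (p + 1) *
             zeta_E (of_nat (2 * k * p)) (of_real a) *
             zeta_E (of_nat (2 * k * (2 * q + 2 - p))) (of_real a))"
  proof (intro arg_cong2[where f = "(*)"] sum.cong refl)
    fix p assume "p \<in> {1..2 * q + 1}"
    \<comment> \<open>The range of \<open>p\<close> keeps the natural-number subtraction positive,
      so \<open>zeta\<close> applies to both factors.\<close>
    then have "0 < p" "0 < 2 * q + 2 - p" "2 * q + 2 - p = 2 * q + 1 + 1 - p"
      by auto
    then show "complex_of_real (\<Sum>n. s n * u n ^ p) = zeta_E (of_nat (2 * k * p)) (of_real a)"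
      and "complex_of_real (\<Sum>n. s n * u n ^ (2 * q + 1 + 1 - p))
        = zeta_E (of_nat (2 * k * (2 * q + 2 - p))) (of_real a)"
      by (simp_all only: zeta)
  qed
  finally show ?thesis
    unfolding inner outer using double(1) sums_summable[OF double(2)] by blast
qed

end
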